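(* Let $p\in(\mathbb{C}\langle\langle x_1,\dots,x_g\rangle\rangle)^g$ be a free formal power series mapping without constant term, with left Jacobian matrix $J_p$. There is a free formal power series mapping $q\in(\mathbb{C}\langle\langle x_1,\dots,x_g\rangle\rangle)^g$ without constant term such that $p$ and $q$ are compositional inverses if and only if $J_p$ has a multiplicative inverse in $M_g(\mathbb{C}\langle\langle x_1,\dots,x_g\rangle\rangle)$. In this case, $J_p(q(x))=J_q^{-1}(x)$. Moreover, $q$ is the unique solution (among mappings without constant term) of $$q(x)=x\,J_p^{-1}(q(x)).$$
   Context: $x=(x_1,\dots,x_g)$ is a row vector of freely noncommuting indeterminates and $\mathbb{C}\langle\langle x_1,\dots,x_g\rangle\rangle$ is the algebra of formal power series in them. For a tuple $\phi=(\phi_1,\dots,\phi_h)$ of formal power series without constant term, the left Jacobian matrix $J_\phi$ is the unique $g\times h$ matrix over $\mathbb{C}\langle\langle x_1,\dots,x_g\rangle\rangle$ with $\phi=xJ_\phi$, i.e. $\phi_j=\sum_{s=1}^g x_s (J_\phi)_{s,j}$. For a matrix $A$ of formal power series and a mapping $q$ without constant term, $A(q(x))$ denotes the matrix obtained by substituting $q_i$ for $x_i$ in each entry. $p$ and $q$ are compositional inverses if $p(q(x))=x=q(p(x))$. $J_p^{-1}$ denotes the multiplicative (matrix) inverse of $J_p$. *)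

theory Defs
  imports "HOL-Analysis.Analysis"
begin

text \<open>
  Formal power series over the complex numbers in freely noncommuting indeterminates indexed by
  the finite type \<open>'g\<close>, whose cardinality is the number of indeterminates. Words are lists over
  \<open>'g\<close>; a series is the family of its coefficients.
\<close>

typedef 'g ncfps = "UNIV :: ('g list \<Rightarrow> complex) set"
  morphisms ncfps_coeff Abs_ncfps
  by simp

setup_lifting type_definition_ncfps

lemma ncfps_eqI: "(\<And>w. ncfps_coeff f w = ncfps_coeff h w) \<Longrightarrow> f = h"
  by (metis ncfps_coeff_inverse ext)

lemma ncfps_eq_iff: "f = h \<longleftrightarrow> (\<forall>w. ncfps_coeff f w = ncfps_coeff h w)"
  by (auto intro: ncfps_eqI)

lemma sum_splits_assoc:
  fixes F :: "'g list \<Rightarrow> 'g list \<Rightarrow> 'g list \<Rightarrow> complex"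
  shows "(\<Sum>i\<le>length w. \<Sum>k\<le>length (take i w).
            F (take k (take i w)) (drop k (take i w)) (drop i w)) =
         (\<Sum>i\<le>length w. \<Sum>k\<le>length (drop i w).
            F (take i w) (take k (drop i w)) (drop k (drop i w)))"
proof -
  have "(\<Sum>i\<le>length w. \<Sum>k\<le>length (take i w).
            F (take k (take i w)) (drop k (take i w)) (drop i w)) =
        (\<Sum>(i,k)\<in>(SIGMA i:{..length w}. {..i}).
            F (take k w) (drop k (take i w)) (drop i w))"
    by (simp add: sum.Sigma [symmetric] min_absorb1)
  also have "\<dots> = (\<Sum>(i,k)\<in>(SIGMA i:{..length w}. {..length w - i}).
            F (take i w) (take k (drop i w)) (drop (i + k) w))"
    by (rule sum.reindex_bij_witness [where j = "\<lambda>(i,k). (k, i - k)" and i = "\<lambda>(i,k). (i + k, i)"])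
       (auto simp: take_drop add.commute)
  also have "\<dots> = (\<Sum>i\<le>length w. \<Sum>k\<le>length (drop i w).
            F (take i w) (take k (drop i w)) (drop k (drop i w)))"
    by (simp add: sum.Sigma [symmetric] add.commute)
  finally show ?thesis .
qed

instantiation ncfps :: (type) ring_1
begin

lift_definition zero_ncfps :: "'a ncfps" is "\<lambda>_. 0" .

lift_definition one_ncfps :: "'a ncfps" is "\<lambda>w. if w = [] then 1 else 0" .

lift_definition plus_ncfps :: "'a ncfps \<Rightarrow> 'a ncfps \<Rightarrow> 'a ncfps" is "\<lambda>f h w. f w + h w" .

lift_definition minus_ncfps :: "'a ncfps \<Rightarrow> 'a ncfps \<Rightarrow> 'a ncfps" is "\<lambda>f h w. f w - h w" .

lift_definition uminus_ncfps :: "'a ncfps \<Rightarrow> 'a ncfps" is "\<lambda>f w. - f w" .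

lift_definition times_ncfps :: "'a ncfps \<Rightarrow> 'a ncfps \<Rightarrow> 'a ncfps"
  is "\<lambda>f h w. \<Sum>i\<le>length w. f (take i w) * h (drop i w)" .

instance
proof
  fix a b c :: "'a ncfps"
  show "a * b * c = a * (b * c)"
  proof (transfer, rule ext)
    fix a b c :: "'a list \<Rightarrow> complex" and w
    show "(\<Sum>i\<le>length w. (\<Sum>k\<le>length (take i w). a (take k (take i w)) * b (drop k (take i w))) *
              c (drop i w)) =
          (\<Sum>i\<le>length w. a (take i w) *
              (\<Sum>k\<le>length (drop i w). b (take k (drop i w)) * c (drop k (drop i w))))"
      using sum_splits_assoc [of "\<lambda>u v z. a u * b v * c z" w]
      by (simp only: sum_distrib_left sum_distrib_right mult.assoc)
  qed
  show "1 * a = a"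
  proof (transfer, rule ext)
    fix a :: "'a list \<Rightarrow> complex" and w
    have "(\<Sum>i\<le>length w. (if take i w = [] then 1 else 0) * a (drop i w)) =
          (\<Sum>i\<le>length w. if i = 0 then a w else 0)"
      by (rule sum.cong) auto
    then show "(\<Sum>i\<le>length w. (if take i w = [] then 1 else 0) * a (drop i w)) = a w"
      by simp
  qed
  show "a * 1 = a"
  proof (transfer, rule ext)
    fix a :: "'a list \<Rightarrow> complex" and w
    have "(\<Sum>i\<le>length w. a (take i w) * (if drop i w = [] then 1 else 0)) =
          (\<Sum>i\<le>length w. if i = length w then a w else 0)"
      by (rule sum.cong) auto
    then show "(\<Sum>i\<le>length w. a (take i w) * (if drop i w = [] then 1 else 0)) = a w"
      by simp
  qed
  show "(0::'a ncfps) \<noteq> 1"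
    by transfer (metis zero_neq_one)
qed (transfer; force simp: algebra_simps sum.distrib)+

end

lift_definition ncfps_var :: "'g \<Rightarrow> 'g ncfps" is "\<lambda>s w. if w = [s] then 1 else 0" .

definition ncfps_vars :: "'g ncfps ^ 'g"
  where "ncfps_vars = (\<chi> s. ncfps_var s)"

definition no_constant_term :: "'g ncfps ^ 'h \<Rightarrow> bool"
  where "no_constant_term p \<longleftrightarrow> (\<forall>j. ncfps_coeff (p $ j) [] = 0)"

definition ncfps_monom_subst :: "'g list \<Rightarrow> 'k ncfps ^ 'g \<Rightarrow> 'k ncfps"
  where "ncfps_monom_subst u q = prod_list (map (\<lambda>s. q $ s) u)"

text \<open>
  Substituting \<open>q\<close> into \<open>f\<close> gives the series with coefficients
  \<open>\<Sum>u. f\<^sub>u (q\<^sub>u)\<^sub>w\<close>, \<open>u\<close> ranging over all words. It is only meaningful if \<open>q\<close> has no constant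
  term; then the terms with \<open>length u > length w\<close> vanish (shown below), so the sum is cut off there.
\<close>

definition ncfps_subst :: "'g::finite ncfps \<Rightarrow> 'k ncfps ^ 'g \<Rightarrow> 'k ncfps"
  where "ncfps_subst f q = Abs_ncfps (\<lambda>w.
    \<Sum>u | length u \<le> length w. ncfps_coeff f u * ncfps_coeff (ncfps_monom_subst u q) w)"

lemma ncfps_coeff_monom_subst_eq_0:
  assumes "no_constant_term q" "length w < length u"
  shows "ncfps_coeff (ncfps_monom_subst u q) w = 0"
  using assms(2)
proof (induction u arbitrary: w)
  case Nil
  then show ?case by simp
next
  case (Cons s u)
  have "ncfps_coeff (q $ s) (take i w) * ncfps_coeff (ncfps_monom_subst u q) (drop i w) = 0"
    if "i \<le> length w" for i
  proof (cases "i = 0")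
    case True
    then show ?thesis using assms(1) by (simp add: no_constant_term_def)
  next
    case False
    then show ?thesis using Cons that by simp
  qed
  then show ?case
    by (auto simp: ncfps_monom_subst_def times_ncfps.rep_eq intro!: sum.neutral)
qed

definition ncfps_vec_subst :: "'g::finite ncfps ^ 'h \<Rightarrow> 'k ncfps ^ 'g \<Rightarrow> 'k ncfps ^ 'h"
  where "ncfps_vec_subst p q = (\<chi> j. ncfps_subst (p $ j) q)"

definition ncfps_mat_subst :: "'g::finite ncfps ^ 'n ^ 'm \<Rightarrow> 'k ncfps ^ 'g \<Rightarrow> 'k ncfps ^ 'n ^ 'm"
  where "ncfps_mat_subst A q = (\<chi> i j. ncfps_subst (A $ i $ j) q)"

definition compositional_inverses :: "'g::finite ncfps ^ 'g \<Rightarrow> 'g ncfps ^ 'g \<Rightarrow> bool"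
  where "compositional_inverses p q \<longleftrightarrow>
    ncfps_vec_subst p q = ncfps_vars \<and> ncfps_vec_subst q p = ncfps_vars"

definition left_jacobian :: "'g::finite ncfps ^ 'h \<Rightarrow> 'g ncfps ^ 'h ^ 'g"
  where "left_jacobian p = (THE J. p = ncfps_vars v* J)"

lemma ncfps_coeff_sum: "ncfps_coeff (sum f A) w = (\<Sum>s\<in>A. ncfps_coeff (f s) w)"
  by (induction A rule: infinite_finite_induct) (simp_all add: zero_ncfps.rep_eq plus_ncfps.rep_eq)

lemma ncfps_coeff_var_mult:
  "ncfps_coeff (ncfps_var s * f) w =
    (case w of [] \<Rightarrow> 0 | t # v \<Rightarrow> if t = s then ncfps_coeff f v else 0)"
proof (cases w)
  case Nil
  then show ?thesis by (simp add: times_ncfps.rep_eq ncfps_var.rep_eq)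
next
  case (Cons t v)
  have "ncfps_coeff (ncfps_var s * f) w =
        (\<Sum>i\<le>length w. if i = 1 then (if t = s then ncfps_coeff f v else 0) else 0)"
    unfolding times_ncfps.rep_eq ncfps_var.rep_eq
    by (rule sum.cong) (auto simp: Cons take_Cons split: nat.splits)
  with Cons show ?thesis by (simp add: Suc_le_eq)
qed

lemma ncfps_coeff_vars_mult:
  fixes J :: "'g::finite ncfps ^ 'h ^ 'g"
  shows "ncfps_coeff ((ncfps_vars v* J) $ j) w =
    (case w of [] \<Rightarrow> 0 | s # v \<Rightarrow> ncfps_coeff (J $ s $ j) v)"
  by (cases w) (simp_all add: vector_matrix_mult_def ncfps_vars_def ncfps_coeff_sum
      ncfps_coeff_var_mult)

lemma left_jacobian_ex1:
  fixes p :: "'g::finite ncfps ^ 'h"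
  assumes "no_constant_term p"
  shows "\<exists>!J. p = ncfps_vars v* J"
proof
  show "p = ncfps_vars v* (\<chi> s j. Abs_ncfps (\<lambda>v. ncfps_coeff (p $ j) (s # v)))"
    using assms
    by (auto simp: vec_eq_iff ncfps_eq_iff ncfps_coeff_vars_mult no_constant_term_def
        Abs_ncfps_inverse split: list.splits)
next
  fix J assume J: "p = ncfps_vars v* J"
  have "ncfps_coeff (J $ s $ j) v = ncfps_coeff (p $ j) (s # v)" for s j v
    by (simp add: J ncfps_coeff_vars_mult)
  then show "J = (\<chi> s j. Abs_ncfps (\<lambda>v. ncfps_coeff (p $ j) (s # v)))"
    by (simp add: vec_eq_iff ncfps_eq_iff Abs_ncfps_inverse)
qed

lemma left_jacobian:
  assumes "no_constant_term p"
  shows "p = ncfps_vars v* left_jacobian p"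
  unfolding left_jacobian_def by (rule theI' [OF left_jacobian_ex1 [OF assms]])

lemma ncfps_coeff_left_jacobian:
  assumes "no_constant_term p"
  shows "ncfps_coeff (left_jacobian p $ s $ j) v = ncfps_coeff (p $ j) (s # v)"
  by (subst (2) left_jacobian [OF assms]) (simp add: ncfps_coeff_vars_mult)

end

theory Submission
  imports Defs
begin

text \<open>
  Write \<open>x\<close> for the row vector of indeterminates, \<open>f(q)\<close> for substitution, and \<open>J\<^sub>p\<close> for the left
  Jacobian matrix. Everything rests on two facts. Substituting a mapping without constant term is
  a unital ring homomorphism, and it is associative; so it commutes with matrix products, and
  applying it to \<open>p = x J\<^sub>p\<close> gives \<open>p(q) = q J\<^sub>p(q)\<close> (\<open>vec_subst_eq_mult_jacobian\<close>). Since left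
  Jacobian matrices are unique, \<open>p(q) = x J\<^sub>q J\<^sub>p(q)\<close> gives the chain rule: the
  Jacobian matrix of \<open>p(q)\<close> is \<open>J\<^sub>q J\<^sub>p(q)\<close>. In particular \<open>p(q) = x\<close> if and only if \<open>J\<^sub>q J\<^sub>p(q) = 1\<close>
  (\<open>vec_subst_eq_vars_iff\<close>).

  If \<open>p\<close> and \<open>q\<close> are inverse to each other, then \<open>J\<^sub>q J\<^sub>p(q) = 1\<close> and \<open>J\<^sub>p J\<^sub>q(p) = 1\<close>. Over a
  noncommutative ring, a one-sided inverse of a matrix need not be two-sided in general; here
  substitution supplies the other side: substituting \<open>p\<close> in the first identity gives \<open>J\<^sub>q(p) J\<^sub>p = 1\<close>, and substituting \<open>q\<close> in the second gives
  \<open>J\<^sub>p(q) J\<^sub>q = 1\<close>. Thus \<open>J\<^sub>p\<^sup>-\<^sup>1 = J\<^sub>q(p)\<close> and \<open>J\<^sub>q\<^sup>-\<^sup>1 = J\<^sub>p(q)\<close>.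

  Conversely, let \<open>A\<close> be the inverse of \<open>J\<^sub>p\<close>. The coefficient of \<open>x A(q)\<close> at a word of length
  \<open>n + 1\<close> only depends on the coefficients of \<open>q\<close> at words of length at most \<open>n\<close>, so
  \<open>q = x A(q)\<close> can be solved degree by degree (\<open>subst_fixed_point_exists\<close>). Any solution satisfies
  \<open>p(q) = q J\<^sub>p(q) = x A(q) J\<^sub>p(q) = x\<close>, so it is a right compositional inverse of \<open>p\<close>, and
  \<open>J\<^sub>q = A(q)\<close> is again invertible. Hence \<open>q\<close> has a right compositional inverse as well, and, as in
  any monoid, that one must be \<open>p\<close>. The same computation gives uniqueness: right
  compositional inverses of \<open>p\<close> coincide as soon as \<open>p\<close> has a left one.
\<close>

section \<open>Substitution as a ring homomorphism\<close>

lemma finite_words_le [simp]: "finite {u :: 'g::finite list. length u \<le> n}"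
  using finite_lists_length_le [of "UNIV :: 'g set" n] by simp

lemma monom_subst_Nil [simp]: "ncfps_monom_subst [] q = 1"
  by (simp add: ncfps_monom_subst_def)

lemma monom_subst_Cons: "ncfps_monom_subst (s # u) q = q $ s * ncfps_monom_subst u q"
  by (simp add: ncfps_monom_subst_def)

lemma monom_subst_append:
  "ncfps_monom_subst (u @ v) q = ncfps_monom_subst u q * ncfps_monom_subst v q"
  by (simp add: ncfps_monom_subst_def)

lemma coeff_subst:
  "ncfps_coeff (ncfps_subst f q) w =
    (\<Sum>u | length u \<le> length w. ncfps_coeff f u * ncfps_coeff (ncfps_monom_subst u q) w)"
  by (simp add: ncfps_subst_def Abs_ncfps_inverse)

text \<open>
  The cut-off in the definition of substitution may be raised freely. This allows the same index
  set to be used for words of different lengths when sums are interchanged.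
\<close>

lemma coeff_subst_cutoff:
  fixes f :: "'g::finite ncfps"
  assumes "no_constant_term q" "length w \<le> n"
  shows "ncfps_coeff (ncfps_subst f q) w =
    (\<Sum>u | length u \<le> n. ncfps_coeff f u * ncfps_coeff (ncfps_monom_subst u q) w)"
  unfolding coeff_subst
  by (rule sum.mono_neutral_left)
    (use assms in \<open>auto simp: ncfps_coeff_monom_subst_eq_0 not_le\<close>)

lemma no_constant_term_vars_mult: "no_constant_term (ncfps_vars v* J)"
  by (simp add: no_constant_term_def ncfps_coeff_vars_mult)

lemma subst_0 [simp]: "ncfps_subst 0 q = 0"
  by (rule ncfps_eqI) (simp add: coeff_subst zero_ncfps.rep_eq)

lemma subst_add: "ncfps_subst (f + h) q = ncfps_subst f q + ncfps_subst h q"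
  by (rule ncfps_eqI) (simp add: coeff_subst plus_ncfps.rep_eq distrib_right sum.distrib)

lemma subst_sum: "ncfps_subst (sum f A) q = (\<Sum>a\<in>A. ncfps_subst (f a) q)"
  by (induction A rule: infinite_finite_induct) (simp_all add: subst_add)

lemma subst_1 [simp]:
  fixes q :: "'k ncfps ^ 'g::finite"
  shows "ncfps_subst 1 q = 1"
proof (rule ncfps_eqI)
  fix w :: "'k list"
  have "ncfps_coeff (ncfps_subst 1 q) w =
    (\<Sum>u :: 'g list | length u \<le> length w. if u = [] then ncfps_coeff 1 w else 0)"
    unfolding coeff_subst by (rule sum.cong) (auto simp: one_ncfps.rep_eq)
  then show "ncfps_coeff (ncfps_subst 1 q) w = ncfps_coeff 1 w"
    by (simp add: sum.delta)
qed

lemma subst_var: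
  fixes q :: "'k ncfps ^ 'g::finite"
  assumes "no_constant_term q"
  shows "ncfps_subst (ncfps_var s) q = q $ s"
proof (rule ncfps_eqI)
  fix w :: "'k list"
  \<comment> \<open>The cut-off is raised to keep the word \<open>[s]\<close> in range when \<open>w\<close> is empty.\<close>
  have "ncfps_coeff (ncfps_subst (ncfps_var s) q) w =
    (\<Sum>u | length u \<le> Suc (length w). if u = [s] then ncfps_coeff (q $ s) w else 0)"
    unfolding coeff_subst_cutoff [OF assms le_SucI [OF order_refl]]
    by (rule sum.cong) (auto simp: ncfps_var.rep_eq monom_subst_Cons)
  then show "ncfps_coeff (ncfps_subst (ncfps_var s) q) w = ncfps_coeff (q $ s) w"
    by (simp add: sum.delta)
qed

text \<open>
  Both sides at \<open>w\<close> are sums over pairs of words \<open>(a, b)\<close>: on the left, these come from splitting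
  one word \<open>a @ b\<close>. The pairs that are missing on the left have \<open>length (a @ b) > length w\<close>, and
  for them the product of the monomials has no coefficient at \<open>w\<close>.
\<close>

lemma subst_mult:
  fixes f h :: "'g::finite ncfps" and q :: "'k ncfps ^ 'g"
  assumes q: "no_constant_term q"
  shows "ncfps_subst (f * h) q = ncfps_subst f q * ncfps_subst h q"
proof (rule ncfps_eqI)
  fix w :: "'k list"
  let ?n = "length w"
  let ?W = "{u :: 'g list. length u \<le> ?n}"
  let ?m = "\<lambda>u. ncfps_monom_subst u q"
  let ?F = "\<lambda>a b. ncfps_coeff f a * ncfps_coeff h b * ncfps_coeff (?m (a @ b)) w"
  have "ncfps_coeff (ncfps_subst (f * h) q) w =
      (\<Sum>u\<in>?W. \<Sum>i\<le>length u. ?F (take i u) (drop i u))"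
    by (simp add: coeff_subst times_ncfps.rep_eq sum_distrib_right)
  also have "\<dots> = (\<Sum>(u, i)\<in>(SIGMA u:?W. {..length u}). ?F (take i u) (drop i u))"
    by (simp add: sum.Sigma)
  also have "\<dots> = (\<Sum>(a, b)\<in>{(a, b). length a + length b \<le> ?n}. ?F a b)"
    by (rule sum.reindex_bij_witness
        [where j = "\<lambda>(u, i). (take i u, drop i u)" and i = "\<lambda>(a, b). (a @ b, length a)"]) auto
  also have "\<dots> = (\<Sum>(a, b)\<in>?W \<times> ?W. ?F a b)"
    by (rule sum.mono_neutral_left)
      (auto, metis length_append ncfps_coeff_monom_subst_eq_0 [OF q] not_le)
  also have "\<dots> = (\<Sum>a\<in>?W. \<Sum>b\<in>?W. \<Sum>i\<le>?n.
      (ncfps_coeff f a * ncfps_coeff (?m a) (take i w)) *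
      (ncfps_coeff h b * ncfps_coeff (?m b) (drop i w)))"
    by (simp add: sum.cartesian_product [symmetric] monom_subst_append times_ncfps.rep_eq
        sum_distrib_left mult_ac)
  also have "\<dots> = (\<Sum>a\<in>?W. \<Sum>i\<le>?n. \<Sum>b\<in>?W.
      (ncfps_coeff f a * ncfps_coeff (?m a) (take i w)) *
      (ncfps_coeff h b * ncfps_coeff (?m b) (drop i w)))"
    by (intro sum.cong refl sum.swap)
  also have "\<dots> = (\<Sum>i\<le>?n. \<Sum>a\<in>?W. \<Sum>b\<in>?W.
      (ncfps_coeff f a * ncfps_coeff (?m a) (take i w)) *
      (ncfps_coeff h b * ncfps_coeff (?m b) (drop i w)))"
    by (rule sum.swap)
  also have "\<dots> = (\<Sum>i\<le>?n. ncfps_coeff (ncfps_subst f q) (take i w) *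
      ncfps_coeff (ncfps_subst h q) (drop i w))"
    by (simp add: coeff_subst_cutoff [OF q, where n = ?n] sum_product)
  finally show "ncfps_coeff (ncfps_subst (f * h) q) w =
      ncfps_coeff (ncfps_subst f q * ncfps_subst h q) w"
    by (simp add: times_ncfps.rep_eq)
qed

lemma subst_monom_subst:
  assumes "no_constant_term r"
  shows "ncfps_subst (ncfps_monom_subst u q) r = ncfps_monom_subst u (ncfps_vec_subst q r)"
  by (induction u) (simp_all add: monom_subst_Cons subst_mult assms ncfps_vec_subst_def)

text \<open>
  Interchanging the two sums reduces this to the case of a monomial, which is multiplicativity.
\<close>

lemma subst_subst:
  fixes f :: "'g::finite ncfps" and q :: "'h::finite ncfps ^ 'g" and r :: "'k ncfps ^ 'h"
  assumes q: "no_constant_term q" and r: "no_constant_term r"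
  shows "ncfps_subst (ncfps_subst f q) r = ncfps_subst f (ncfps_vec_subst q r)"
proof (rule ncfps_eqI)
  fix w :: "'k list"
  let ?n = "length w"
  have "ncfps_coeff (ncfps_subst (ncfps_subst f q) r) w =
      (\<Sum>v | length v \<le> ?n. \<Sum>u | length u \<le> ?n. ncfps_coeff f u *
        (ncfps_coeff (ncfps_monom_subst u q) v * ncfps_coeff (ncfps_monom_subst v r) w))"
    by (simp add: coeff_subst [of _ r] coeff_subst_cutoff [OF q, where n = ?n]
        sum_distrib_right mult.assoc)
  also have "\<dots> = (\<Sum>u | length u \<le> ?n. \<Sum>v | length v \<le> ?n. ncfps_coeff f u *
        (ncfps_coeff (ncfps_monom_subst u q) v * ncfps_coeff (ncfps_monom_subst v r) w))"
    by (rule sum.swap)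
  also have "\<dots> = (\<Sum>u | length u \<le> ?n. ncfps_coeff f u *
        ncfps_coeff (ncfps_subst (ncfps_monom_subst u q) r) w)"
    by (simp add: coeff_subst [of _ r] sum_distrib_left)
  also have "\<dots> = ncfps_coeff (ncfps_subst f (ncfps_vec_subst q r)) w"
    by (simp add: coeff_subst subst_monom_subst [OF r])
  finally show "ncfps_coeff (ncfps_subst (ncfps_subst f q) r) w =
      ncfps_coeff (ncfps_subst f (ncfps_vec_subst q r)) w" .
qed

lemma coeff_monom_subst_vars:
  "ncfps_coeff (ncfps_monom_subst u ncfps_vars) w = (if w = u then 1 else 0)"
  by (induction u arbitrary: w)
    (auto simp: one_ncfps.rep_eq monom_subst_Cons ncfps_vars_def ncfps_coeff_var_mult
      split: list.splits)

lemma subst_vars [simp]: "ncfps_subst f ncfps_vars = f"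
proof (rule ncfps_eqI)
  fix w
  have "ncfps_coeff (ncfps_subst f ncfps_vars) w =
    (\<Sum>u | length u \<le> length w. if u = w then ncfps_coeff f w else 0)"
    unfolding coeff_subst by (rule sum.cong) (auto simp: coeff_monom_subst_vars)
  then show "ncfps_coeff (ncfps_subst f ncfps_vars) w = ncfps_coeff f w"
    by (simp add: sum.delta)
qed

section \<open>Substitution in mappings and matrices\<close>

lemma vec_subst_subst:
  assumes "no_constant_term q" "no_constant_term r"
  shows "ncfps_vec_subst (ncfps_vec_subst p q) r = ncfps_vec_subst p (ncfps_vec_subst q r)"
  by (simp add: vec_eq_iff ncfps_vec_subst_def [of _ r] ncfps_vec_subst_def [of p]
      subst_subst [OF assms])

lemma vec_subst_vars_left [simp]:
  assumes "no_constant_term q"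
  shows "ncfps_vec_subst ncfps_vars q = q"
  by (simp add: vec_eq_iff ncfps_vec_subst_def ncfps_vars_def subst_var [OF assms])

lemma vec_subst_vars_right [simp]: "ncfps_vec_subst p ncfps_vars = p"
  by (simp add: vec_eq_iff ncfps_vec_subst_def)

lemma mat_subst_vars [simp]: "ncfps_mat_subst A ncfps_vars = A"
  by (simp add: vec_eq_iff ncfps_mat_subst_def)

lemma mat_subst_mat_1 [simp]: "ncfps_mat_subst (mat 1) q = mat 1"
  by (simp add: vec_eq_iff ncfps_mat_subst_def mat_def)

lemma mat_subst_subst:
  assumes "no_constant_term q" "no_constant_term r"
  shows "ncfps_mat_subst (ncfps_mat_subst A q) r = ncfps_mat_subst A (ncfps_vec_subst q r)"
  by (simp add: vec_eq_iff ncfps_mat_subst_def subst_subst [OF assms])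

lemma mat_subst_mult:
  assumes "no_constant_term q"
  shows "ncfps_mat_subst (A ** B) q = ncfps_mat_subst A q ** ncfps_mat_subst B q"
  by (simp add: vec_eq_iff ncfps_mat_subst_def matrix_matrix_mult_def subst_sum
      subst_mult [OF assms])

lemma vec_subst_vector_matrix_mult:
  assumes "no_constant_term q"
  shows "ncfps_vec_subst (v v* A) q = ncfps_vec_subst v q v* ncfps_mat_subst A q"
  by (simp add: vec_eq_iff ncfps_vec_subst_def ncfps_mat_subst_def vector_matrix_mult_def
      subst_sum subst_mult [OF assms])

section \<open>The chain rule for left Jacobian matrices\<close>

lemma left_jacobian_vars_mult [simp]: "left_jacobian (ncfps_vars v* J) = J"
  using left_jacobian_ex1 [OF no_constant_term_vars_mult] left_jacobian [OF no_constant_term_vars_mult]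
  by blast

lemma vars_mult_eq_vars_iff: "ncfps_vars v* J = ncfps_vars \<longleftrightarrow> J = mat 1"
  by (metis left_jacobian_vars_mult vector_matrix_mul_rid)

lemma vec_subst_eq_mult_jacobian:
  assumes "no_constant_term p" "no_constant_term q"
  shows "ncfps_vec_subst p q = q v* ncfps_mat_subst (left_jacobian p) q"
  using vec_subst_vector_matrix_mult [OF assms(2), of ncfps_vars "left_jacobian p"]
  by (simp add: left_jacobian [OF assms(1), symmetric] assms(2))

lemma vec_subst_chain_rule:
  assumes "no_constant_term p" "no_constant_term q"
  shows "ncfps_vec_subst p q =
    ncfps_vars v* (left_jacobian q ** ncfps_mat_subst (left_jacobian p) q)"
  using vec_subst_eq_mult_jacobian [OF assms]
  by (simp add: vector_matrix_mul_assoc [symmetric] left_jacobian [OF assms(2), symmetric])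

lemma vec_subst_eq_vars_iff:
  assumes "no_constant_term p" "no_constant_term q"
  shows "ncfps_vec_subst p q = ncfps_vars \<longleftrightarrow>
    left_jacobian q ** ncfps_mat_subst (left_jacobian p) q = mat 1"
  by (simp add: vec_subst_chain_rule [OF assms] vars_mult_eq_vars_iff)

section \<open>Solving the fixed-point equation\<close>

text \<open>
  The classes of this relation are the balls of an ultrametric for which \<open>q \<mapsto> x A(q)\<close> is a
  contraction.
\<close>

definition agree_upto :: "nat \<Rightarrow> 'k ncfps ^ 'g \<Rightarrow> 'k ncfps ^ 'g \<Rightarrow> bool"
  where "agree_upto n q r \<longleftrightarrow>
    (\<forall>s w. length w \<le> n \<longrightarrow> ncfps_coeff (q $ s) w = ncfps_coeff (r $ s) w)"

lemma agree_upto_refl: "agree_upto n q q"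
  by (simp add: agree_upto_def)

lemma agree_upto_trans: "agree_upto n q r \<Longrightarrow> agree_upto n r t \<Longrightarrow> agree_upto n q t"
  by (simp add: agree_upto_def)

lemma agree_upto_mono: "agree_upto n q r \<Longrightarrow> m \<le> n \<Longrightarrow> agree_upto m q r"
  by (simp add: agree_upto_def)

lemma coeff_monom_subst_agree:
  assumes "agree_upto n q r" "length w \<le> n"
  shows "ncfps_coeff (ncfps_monom_subst u q) w = ncfps_coeff (ncfps_monom_subst u r) w"
  using assms(2)
proof (induction u arbitrary: w)
  case Nil
  then show ?case by simp
next
  case (Cons s u)
  with assms(1) show ?case
    by (auto simp: monom_subst_Cons times_ncfps.rep_eq agree_upto_def intro!: sum.cong)
qed

lemma coeff_subst_agree:
  assumes "agree_upto n q r" "length w \<le> n"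
  shows "ncfps_coeff (ncfps_subst f q) w = ncfps_coeff (ncfps_subst f r) w"
  by (simp add: coeff_subst coeff_monom_subst_agree [OF assms])

text \<open>The factor \<open>x\<close> raises the degree by one, whence the contraction.\<close>

lemma agree_upto_vars_mult_subst:
  assumes "agree_upto n q r"
  shows "agree_upto (Suc n) (ncfps_vars v* ncfps_mat_subst A q) (ncfps_vars v* ncfps_mat_subst A r)"
  using assms
  by (auto simp: agree_upto_def [of "Suc n"] ncfps_coeff_vars_mult ncfps_mat_subst_def
      intro: coeff_subst_agree split: list.splits)

text \<open>
  The iterates of the contraction, started at \<open>0\<close>, agree with all later ones up to a degree that
  grows with the index; the solution takes its coefficients of degree \<open>n\<close> from the \<open>n\<close>-th one.
\<close>

lemma subst_fixed_point_exists:
  fixes A :: "'g::finite ncfps ^ 'g ^ 'g"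
  shows "\<exists>q. q = ncfps_vars v* ncfps_mat_subst A q"
proof -
  define T where "T = (\<lambda>q. ncfps_vars v* ncfps_mat_subst A q)"
  define Q where "Q = (\<lambda>n. (T ^^ n) 0)"
  define q :: "'g ncfps ^ 'g"
    where "q = (\<chi> s. Abs_ncfps (\<lambda>w. ncfps_coeff (Q (length w) $ s) w))"
  have step: "agree_upto n (Q n) (Q (Suc n))" for n
  proof (induction n)
    case 0
    \<comment> \<open>In degree \<open>0\<close> the claim is that \<open>T 0\<close> has no constant term.\<close>
    show ?case
      by (simp add: Q_def T_def agree_upto_def ncfps_coeff_vars_mult zero_ncfps.rep_eq)
  next
    case (Suc n)
    then show ?case
      using agree_upto_vars_mult_subst [OF Suc, of A] by (simp add: Q_def T_def)
  qed
  have "agree_upto n (Q n) (Q m)" if "n \<le> m" for n m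
    using that
  proof (induction m rule: dec_induct)
    case base
    show ?case by (rule agree_upto_refl)
  next
    case (step m)
    then show ?case
      using \<open>agree_upto m (Q m) (Q (Suc m))\<close> agree_upto_mono agree_upto_trans by blast
  qed
  then have q_Q: "agree_upto n q (Q n)" for n
    by (simp add: agree_upto_def q_def Abs_ncfps_inverse)
  have "agree_upto (Suc n) q (T q)" for n
    using q_Q [of "Suc n"] agree_upto_vars_mult_subst [OF q_Q [of n], of A]
    by (simp add: agree_upto_def Q_def T_def)
  then have "agree_upto n q (T q)" for n
    by (meson agree_upto_mono le_SucI order_refl)
  then have "ncfps_coeff (q $ s) w = ncfps_coeff (T q $ s) w" for s w
    unfolding agree_upto_def by blast
  then have "q = T q"
    unfolding vec_eq_iff by (blast intro: ncfps_eqI)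
  then show ?thesis
    unfolding T_def by blast
qed

section \<open>Compositional inverses\<close>

lemma matrix_inv_eqI:
  assumes "A ** B = mat 1" "B ** A = mat 1"
  shows "invertible A" "matrix_inv A = B"
proof -
  show "invertible A"
    using assms by (auto simp: invertible_def)
  have "B' = B" if "A ** B' = mat 1 \<and> B' ** A = mat 1" for B'
    by (metis assms(1) that matrix_mul_assoc matrix_mul_lid matrix_mul_rid)
  then show "matrix_inv A = B"
    unfolding matrix_inv_def using assms by (blast intro: some_equality)
qed

lemma matrix_inv_mult_left: "invertible A \<Longrightarrow> matrix_inv A ** A = mat 1"
  unfolding invertible_def using matrix_inv_eqI(2) by blast

lemma compositional_inverses_commute: "compositional_inverses p q \<longleftrightarrow> compositional_inverses q p"
  by (auto simp: compositional_inverses_def)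

text \<open>
  One of the two products is the chain rule for \<open>p(q) = x\<close>; the other one is the chain rule for
  \<open>q(p) = x\<close> after substituting \<open>q\<close>.
\<close>

lemma left_jacobian_compositional_inverse:
  assumes p: "no_constant_term p" and q: "no_constant_term q"
    and pq: "compositional_inverses p q"
  shows "invertible (left_jacobian q)"
    and "matrix_inv (left_jacobian q) = ncfps_mat_subst (left_jacobian p) q"
proof -
  have *: "ncfps_vec_subst p q = ncfps_vars" "ncfps_vec_subst q p = ncfps_vars"
    using pq by (simp_all add: compositional_inverses_def)
  have right: "left_jacobian q ** ncfps_mat_subst (left_jacobian p) q = mat 1"
    using * vec_subst_eq_vars_iff [OF p q] by simp
  have "left_jacobian p ** ncfps_mat_subst (left_jacobian q) p = mat 1"
    using * vec_subst_eq_vars_iff [OF q p] by simp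
  then have "ncfps_mat_subst (left_jacobian p ** ncfps_mat_subst (left_jacobian q) p) q = mat 1"
    by simp
  then have left: "ncfps_mat_subst (left_jacobian p) q ** left_jacobian q = mat 1"
    by (simp add: mat_subst_mult [OF q] mat_subst_subst [OF p q] *)
  show "invertible (left_jacobian q)"
    and "matrix_inv (left_jacobian q) = ncfps_mat_subst (left_jacobian p) q"
    using matrix_inv_eqI [OF right left] by auto
qed

lemma fixed_point_is_right_inverse:
  assumes p: "no_constant_term p" and q: "no_constant_term q"
    and A: "A ** left_jacobian p = mat 1"
    and fp: "q = ncfps_vars v* ncfps_mat_subst A q"
  shows "ncfps_vec_subst p q = ncfps_vars"
proof -
  have "ncfps_vec_subst p q = q v* ncfps_mat_subst (left_jacobian p) q"
    by (rule vec_subst_eq_mult_jacobian [OF p q])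
  also have "\<dots> = (ncfps_vars v* ncfps_mat_subst A q) v* ncfps_mat_subst (left_jacobian p) q"
    by (subst (1) fp) (rule refl)
  also have "\<dots> = ncfps_vars v* ncfps_mat_subst (A ** left_jacobian p) q"
    by (simp add: vector_matrix_mul_assoc mat_subst_mult [OF q])
  finally show ?thesis
    by (simp add: A)
qed

text \<open>
  The invertibility of \<open>J\<^sub>q\<close> is part of the conclusion so that the lemma can be applied to \<open>q\<close>
  in turn.
\<close>

lemma right_inverse_exists:
  fixes p :: "'g::finite ncfps ^ 'g"
  assumes p: "no_constant_term p" and inv: "invertible (left_jacobian p)"
  obtains q where "no_constant_term q" "ncfps_vec_subst p q = ncfps_vars"
    "invertible (left_jacobian q)"
proof -
  obtain A where A: "left_jacobian p ** A = mat 1" "A ** left_jacobian p = mat 1"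
    using inv by (auto simp: invertible_def)
  obtain q where fp: "q = ncfps_vars v* ncfps_mat_subst A q"
    using subst_fixed_point_exists by blast
  have q: "no_constant_term q"
    by (subst fp) (rule no_constant_term_vars_mult)
  have "left_jacobian q = ncfps_mat_subst A q"
    by (subst fp) (rule left_jacobian_vars_mult)
  moreover have "ncfps_mat_subst A q ** ncfps_mat_subst (left_jacobian p) q = mat 1"
    "ncfps_mat_subst (left_jacobian p) q ** ncfps_mat_subst A q = mat 1"
    using A by (simp_all add: mat_subst_mult [OF q, symmetric])
  ultimately have "invertible (left_jacobian q)"
    by (auto simp: invertible_def)
  then show ?thesis
    using that q fixed_point_is_right_inverse [OF p q A(2) fp] by blast
qed

text \<open>By associativity, \<open>r = r(p(q)) = q\<close>.\<close>

lemma left_right_inverse_unique: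
  assumes "no_constant_term p" "no_constant_term q"
    and "ncfps_vec_subst r p = ncfps_vars" "ncfps_vec_subst p q = ncfps_vars"
  shows "q = r"
  using vec_subst_subst [of p q r] assms by simp

lemma compositional_inverse_exists:
  fixes p :: "'g::finite ncfps ^ 'g"
  assumes p: "no_constant_term p" and inv: "invertible (left_jacobian p)"
  shows "\<exists>q. no_constant_term q \<and> compositional_inverses p q"
proof -
  obtain q where q: "no_constant_term q" "ncfps_vec_subst p q = ncfps_vars"
    "invertible (left_jacobian q)"
    using right_inverse_exists [OF p inv] .
  obtain r where r: "no_constant_term r" "ncfps_vec_subst q r = ncfps_vars"
    using right_inverse_exists [OF q(1,3)] .
  have "r = p"
    by (rule left_right_inverse_unique [OF q(1) r(1) q(2) r(2)])
  then show ?thesis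
    using q r by (auto simp: compositional_inverses_def)
qed

theorem proposition3p12:
  fixes p :: "'g::finite ncfps ^ 'g"
  assumes "no_constant_term p"
  shows "((\<exists>q. no_constant_term q \<and> compositional_inverses p q) \<longleftrightarrow>
            invertible (left_jacobian p)) \<and>
         (\<forall>q. no_constant_term q \<and> compositional_inverses p q \<longrightarrow>
            invertible (left_jacobian q) \<and>
            ncfps_mat_subst (left_jacobian p) q = matrix_inv (left_jacobian q) \<and>
            q = ncfps_vars v* ncfps_mat_subst (matrix_inv (left_jacobian p)) q \<and>
            (\<forall>q'. no_constant_term q' \<and>
                  q' = ncfps_vars v* ncfps_mat_subst (matrix_inv (left_jacobian p)) q' \<longrightarrow>
                  q' = q))"
proof (intro conjI allI impI)
  show "(\<exists>q. no_constant_term q \<and> compositional_inverses p q) \<longleftrightarrow> invertible (left_jacobian p)"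
    using left_jacobian_compositional_inverse(1) [OF _ assms]
      compositional_inverse_exists [OF assms] compositional_inverses_commute
    by blast
next
  fix q
  assume "no_constant_term q \<and> compositional_inverses p q"
  then have q: "no_constant_term q" and pq: "compositional_inverses p q"
    and qp: "compositional_inverses q p"
    by (simp_all add: compositional_inverses_commute)
  have comp: "ncfps_vec_subst p q = ncfps_vars" "ncfps_vec_subst q p = ncfps_vars"
    using pq by (simp_all add: compositional_inverses_def)
  show "invertible (left_jacobian q)"
    by (rule left_jacobian_compositional_inverse(1) [OF assms q pq])
  show "ncfps_mat_subst (left_jacobian p) q = matrix_inv (left_jacobian q)"
    by (rule left_jacobian_compositional_inverse(2) [OF assms q pq, symmetric])
  have inv_p: "matrix_inv (left_jacobian p) = ncfps_mat_subst (left_jacobian q) p"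
    by (rule left_jacobian_compositional_inverse(2) [OF q assms qp])
  \<comment> \<open>Hence \<open>J\<^sub>p\<^sup>-\<^sup>1(q) = J\<^sub>q(p(q)) = J\<^sub>q\<close>, and the equation for \<open>q\<close> is the definition of \<open>J\<^sub>q\<close>.\<close>
  then have "ncfps_mat_subst (matrix_inv (left_jacobian p)) q = left_jacobian q"
    by (simp add: mat_subst_subst [OF assms q] comp)
  then show "q = ncfps_vars v* ncfps_mat_subst (matrix_inv (left_jacobian p)) q"
    using left_jacobian [OF q] by simp
  fix q'
  assume "no_constant_term q' \<and>
    q' = ncfps_vars v* ncfps_mat_subst (matrix_inv (left_jacobian p)) q'"
  then have q': "no_constant_term q'"
    and fp': "q' = ncfps_vars v* ncfps_mat_subst (matrix_inv (left_jacobian p)) q'"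
    by blast+
  have "matrix_inv (left_jacobian p) ** left_jacobian p = mat 1"
    by (rule matrix_inv_mult_left [OF left_jacobian_compositional_inverse(1) [OF q assms qp]])
  then have "ncfps_vec_subst p q' = ncfps_vars"
    by (rule fixed_point_is_right_inverse [OF assms q' _ fp'])
  then show "q' = q"
    by (rule left_right_inverse_unique [OF assms q' comp(2)])
qed

end
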